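(* Let $\Gamma$ be a gain operator on $\ell^\infty_+(\mathcal I)$. The following are equivalent: (a) there is $\rho\in\mathcal K_\infty$ such that $\Gamma_\rho$ satisfies the $\oplus$-MBI property; (b) there exist $\rho\in\mathcal K_\infty$ and a path $\sigma:\mathbb R_+\to\ell^\infty_+(\mathcal I)$ such that: $\sigma(r)\in\Psi(\Gamma_\rho)$ for all $r\ge0$; $\varphi_{\min}(r)\mathbf 1\le\sigma(r)\le\varphi_{\max}(r)\mathbf 1$ for all $r\ge0$ for some $\varphi_{\min},\varphi_{\max}\in\mathcal K_\infty$; $\sigma$ is increasing; (C1) $\sigma$ is norm-continuous from below, i.e. $\rho_n\to\rho_0$ from below implies $\|\sigma(\rho_n)-\sigma(\rho_0)\|\to0$; (C2) $\sigma$ is sequentially weak$^*$ continuous from above, i.e. $\rho_n\to\rho_0$ from above implies $\sigma(\rho_n)\to\sigma(\rho_0)$ weak$^*$.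
   Context: Let $\mathcal I$ be a nonempty countable index set; $\ell^\infty_+(\mathcal I)$ is the cone of nonnegative real families $s=(s_i)_{i\in\mathcal I}$ with $\|s\|:=\sup_i|s_i|<\infty$, ordered componentwise; $\mathbf 1$ is the all-ones vector; $\oplus$ is the componentwise maximum. A sequence in $\ell^\infty(\mathcal I)$ converges weak$^*$ (viewing $\ell^\infty=(\ell^1)^*$) iff it is norm-bounded and converges componentwise. $\mathcal K_\infty$: continuous strictly increasing unbounded $\gamma:\mathbb R_+\to\mathbb R_+$ with $\gamma(0)=0$, acting componentwise. For $\mathcal J\subset\mathcal I$, $s_{|\mathcal J}$ agrees with $s$ on $\mathcal J$ and is $0$ elsewhere. Gain operator: for each $i$ a finite (possibly empty) $\mathcal I_i\subset\mathcal I\setminus\{i\}$; directed graph $\mathcal G$ with vertices $\mathcal I$ and edges $ji$, $j\in\mathcal I_i$; a pointwise equicontinuous family $\gamma_{ij}\in\mathcal K_\infty$ ($ji\in E(\mathcal G)$); functions $\mu_i:\ell^\infty_+(\mathcal I)\to[0,\infty]$ with (M1) some $\xi\in\mathcal K_\infty$ has $\mu_i(0)=0$, $\mu_i(s)\ge\xi(\|s\|)$; (M2) $\mu_i$ monotone; (M3) for each finite $\mathcal J$, $\mu_i$ restricted to vectors vanishing off $\mathcal J$ is finite-valued and continuous; (M4) for each norm-bounded $A$ and $\varepsilon>0$ there is $\delta>0$ with $\sup_i|\mu_i(s_{|\mathcal I_i})-\mu_i(s^0_{|\mathcal I_i})|\le\varepsilon$ whenever $s^0\in A$, $\|s-s^0\|\le\delta$.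 $\Gamma_i(s):=\mu_i([\gamma_{ij}(s_j)]_{j\in\mathcal I_i})$ (argument zero outside $\mathcal I_i$). $\Gamma_\rho:=(\mathrm{id}+\rho)\circ\Gamma$. $\Psi(T):=\{s:T(s)\le s\}$. A monotone $T$ has the $\oplus$-MBI property if there is $\varphi\in\mathcal K_\infty$ such that for all $s,b$, $s\le b\oplus T(s)$ implies $\|s\|\le\varphi(\|b\|)$. *)

theory Defs
  imports "HOL-Analysis.Analysis" "HOL-Library.Extended_Real"
begin

definition linf_pos :: "('i \<Rightarrow> real) set" where
  "linf_pos = {s. (\<forall>i. 0 \<le> s i) \<and> bdd_above (range (\<lambda>i. \<bar>s i\<bar>))}"

definition linf_norm :: "('i \<Rightarrow> real) \<Rightarrow> real" where
  "linf_norm s = (SUP i. \<bar>s i\<bar>)"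

definition Kinf :: "(real \<Rightarrow> real) \<Rightarrow> bool" where
  "Kinf g \<longleftrightarrow> g 0 = 0 \<and> continuous_on {0..} g \<and> strict_mono_on {0..} g
     \<and> (\<forall>M. \<exists>r\<ge>0. M < g r)"

definition restr :: "('i \<Rightarrow> real) \<Rightarrow> 'i set \<Rightarrow> 'i \<Rightarrow> real" where
  "restr s J = (\<lambda>i. if i \<in> J then s i else 0)"

text \<open>Gain operator data: neighbour sets II, gains gam i j (edge j -> i), functions mu i.\<close>
definition gain_operator ::
  "('i \<Rightarrow> 'i set) \<Rightarrow> ('i \<Rightarrow> 'i \<Rightarrow> real \<Rightarrow> real) \<Rightarrow> ('i \<Rightarrow> ('i \<Rightarrow> real) \<Rightarrow> ereal) \<Rightarrow> bool" where
  "gain_operator II gam mu \<longleftrightarrow>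
     (\<forall>i. finite (II i) \<and> i \<notin> II i)
   \<and> (\<forall>i. \<forall>j\<in>II i. Kinf (gam i j))
   \<comment> \<open>pointwise equicontinuity of the family of gains\<close>
   \<and> (\<forall>r\<ge>0. \<forall>\<epsilon>>0. \<exists>\<delta>>0. \<forall>i. \<forall>j\<in>II i. \<forall>r'\<ge>0.
          \<bar>r' - r\<bar> < \<delta> \<longrightarrow> \<bar>gam i j r' - gam i j r\<bar> < \<epsilon>)
   \<comment> \<open>values in [0,oo]\<close>
   \<and> (\<forall>i. \<forall>s\<in>linf_pos. 0 \<le> mu i s)
   \<comment> \<open>(M1)\<close>
   \<and> (\<exists>\<xi>. Kinf \<xi> \<and> (\<forall>i. mu i (\<lambda>_. 0) = 0 \<and>
          (\<forall>s\<in>linf_pos. ereal (\<xi> (linf_norm s)) \<le> mu i s)))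
   \<comment> \<open>(M2)\<close>
   \<and> (\<forall>i. \<forall>s\<in>linf_pos. \<forall>s'\<in>linf_pos. (\<forall>k. s k \<le> s' k) \<longrightarrow> mu i s \<le> mu i s')
   \<comment> \<open>(M3)\<close>
   \<and> (\<forall>i J. finite J \<longrightarrow>
        (\<forall>s\<in>linf_pos. (\<forall>k. k \<notin> J \<longrightarrow> s k = 0) \<longrightarrow>
           mu i s \<noteq> \<infinity> \<and>
           (\<forall>\<epsilon>>0. \<exists>\<delta>>0. \<forall>s'\<in>linf_pos. (\<forall>k. k \<notin> J \<longrightarrow> s' k = 0) \<longrightarrow>
               linf_norm (\<lambda>k. s' k - s k) < \<delta> \<longrightarrow>
               \<bar>real_of_ereal (mu i s') - real_of_ereal (mu i s)\<bar> < \<epsilon>)))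
   \<comment> \<open>(M4), norm-bounded sets A being subsets of balls of radius R\<close>
   \<and> (\<forall>R. \<forall>\<epsilon>>0. \<exists>\<delta>>0. \<forall>i. \<forall>s\<in>linf_pos. \<forall>s0\<in>linf_pos.
        linf_norm s0 \<le> R \<longrightarrow> linf_norm (\<lambda>k. s k - s0 k) \<le> \<delta> \<longrightarrow>
        \<bar>mu i (restr s (II i)) - mu i (restr s0 (II i))\<bar> \<le> ereal \<epsilon>)"

text \<open>The gain operator Gamma (finite values by (M3)) and Gamma_rho.\<close>
definition Gam ::
  "('i \<Rightarrow> 'i set) \<Rightarrow> ('i \<Rightarrow> 'i \<Rightarrow> real \<Rightarrow> real) \<Rightarrow> ('i \<Rightarrow> ('i \<Rightarrow> real) \<Rightarrow> ereal)
     \<Rightarrow> ('i \<Rightarrow> real) \<Rightarrow> 'i \<Rightarrow> real" where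
  "Gam II gam mu s = (\<lambda>i. real_of_ereal (mu i (\<lambda>j. if j \<in> II i then gam i j (s j) else 0)))"

definition Gam_rho ::
  "('i \<Rightarrow> 'i set) \<Rightarrow> ('i \<Rightarrow> 'i \<Rightarrow> real \<Rightarrow> real) \<Rightarrow> ('i \<Rightarrow> ('i \<Rightarrow> real) \<Rightarrow> ereal)
     \<Rightarrow> (real \<Rightarrow> real) \<Rightarrow> ('i \<Rightarrow> real) \<Rightarrow> 'i \<Rightarrow> real" where
  "Gam_rho II gam mu \<rho> s = (\<lambda>i. Gam II gam mu s i + \<rho> (Gam II gam mu s i))"

definition Psi :: "(('i \<Rightarrow> real) \<Rightarrow> 'i \<Rightarrow> real) \<Rightarrow> ('i \<Rightarrow> real) set" where
  "Psi T = {s \<in> linf_pos. \<forall>i. T s i \<le> s i}"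

definition oplus_MBI :: "(('i \<Rightarrow> real) \<Rightarrow> 'i \<Rightarrow> real) \<Rightarrow> bool" where
  "oplus_MBI T \<longleftrightarrow> (\<exists>\<phi>. Kinf \<phi> \<and> (\<forall>s\<in>linf_pos. \<forall>b\<in>linf_pos.
      (\<forall>i. s i \<le> max (b i) (T s i)) \<longrightarrow> linf_norm s \<le> \<phi> (linf_norm b)))"

definition weak_star_tendsto :: "(nat \<Rightarrow> 'i \<Rightarrow> real) \<Rightarrow> ('i \<Rightarrow> real) \<Rightarrow> bool" where
  "weak_star_tendsto x x0 \<longleftrightarrow> (\<exists>B. \<forall>n. linf_norm (x n) \<le> B) \<and> (\<forall>i. (\<lambda>n. x n i) \<longlonglongrightarrow> x0 i)"

end

theory Submission
  imports Defs
begin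

text \<open>
  From (a) to (b), put \<open>T = \<Gamma>\<^sub>\<rho>\<close>. By the MBI property the pointwise supremum of all \<open>s\<close> with
  \<open>s \<le> c\<one> \<oplus> T(s)\<close> exists; it is the largest fixed point of \<open>s \<mapsto> c\<one> \<oplus> T(s)\<close>. Iterating this map from the
  largest fixed point at level \<open>2c\<close> gives a decreasing sequence that converges componentwise, but in
  general not in norm, to the one at level \<open>c\<close>. If \<open>x\<^sub>n\<^sub>+\<^sub>1 \<le> s \<le> x\<^sub>n\<close> for consecutive iterates, then
  \<open>T(s) \<le> T(x\<^sub>n) \<le> x\<^sub>n\<^sub>+\<^sub>1 \<le> s\<close>, so any interpolation stays in \<open>\<Psi>(T)\<close>. The path interpolates these sequences
  over the intervals \<open>(c, 2c]\<close> for \<open>c\<close> a power of two; weak* continuity from above is all one gets at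
  the left end points.

  From (b) to (a), replace \<open>\<rho>\<close> by \<open>\<rho>/2\<close>. If \<open>s \<le> b \<oplus> \<Gamma>\<^bsub>\<rho>/2\<^esub>(s)\<close>, let \<open>r\<^sub>0\<close> be the infimum of all \<open>r\<close> with
  \<open>s \<le> \<sigma>(r)\<close>. By (C2) it is attained, and were \<open>\<parallel>b\<parallel> < \<phi>\<^sub>m\<^sub>i\<^sub>n(r\<^sub>0)\<close>, the uniform gap between
  \<open>\<Gamma>\<^bsub>\<rho>/2\<^esub>(\<sigma>(r\<^sub>0))\<close> and \<open>\<sigma>(r\<^sub>0)\<close> together with (C1) would give \<open>s \<le> \<sigma>(r)\<close> for some \<open>r < r\<^sub>0\<close>.
\<close>

subsection \<open>Bounded families and comparison functions\<close>

lemma linf_posI: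
  assumes "\<And>i. 0 \<le> s i" "\<And>i. s i \<le> B"
  shows "s \<in> linf_pos"
  using assms unfolding linf_pos_def by (auto intro!: bdd_aboveI[of _ B])

lemma linf_pos_nonneg: "s \<in> linf_pos \<Longrightarrow> 0 \<le> s i"
  unfolding linf_pos_def by auto

lemma le_linf_norm:
  assumes "s \<in> linf_pos"
  shows "s i \<le> linf_norm s"
proof -
  have "\<bar>s i\<bar> \<le> (SUP i. \<bar>s i\<bar>)"
    using assms unfolding linf_pos_def by (intro cSUP_upper) auto
  then show ?thesis
    unfolding linf_norm_def by linarith
qed

lemma linf_norm_le:
  assumes "\<And>i. \<bar>s i\<bar> \<le> B"
  shows "linf_norm s \<le> B"
  unfolding linf_norm_def using assms by (intro cSUP_least) auto

text \<open>A real supremum bounds its members only if the family is bounded, so the difference is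
  first estimated by \<open>linf_norm s + linf_norm t\<close>.\<close>

lemma abs_diff_le_linf_norm:
  assumes "s \<in> linf_pos" "t \<in> linf_pos"
  shows "\<bar>s i - t i\<bar> \<le> linf_norm (\<lambda>i. s i - t i)"
proof -
  have "\<bar>s j - t j\<bar> \<le> linf_norm s + linf_norm t" for j
    using le_linf_norm[OF assms(1), of j] le_linf_norm[OF assms(2), of j]
      linf_pos_nonneg[OF assms(1), of j] linf_pos_nonneg[OF assms(2), of j] by linarith
  then show ?thesis
    unfolding linf_norm_def by (intro cSUP_upper bdd_aboveI) auto
qed

lemma linf_norm_nonneg: "s \<in> linf_pos \<Longrightarrow> 0 \<le> linf_norm s"
  using le_linf_norm[of s undefined] linf_pos_nonneg[of s undefined] by linarith

lemma linf_pos_downward: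
  assumes "t \<in> linf_pos" "\<And>i. 0 \<le> s i" "s \<le> t"
  shows "s \<in> linf_pos"
  using assms le_linf_norm[OF assms(1)] unfolding le_fun_def
  by (intro linf_posI[of s "linf_norm t"]) (auto intro: order_trans)

lemma Kinf_mono: "Kinf f \<Longrightarrow> 0 \<le> x \<Longrightarrow> x \<le> y \<Longrightarrow> f x \<le> f y"
  unfolding Kinf_def strict_mono_on_def by (cases "x = y") (auto intro: less_imp_le)

lemma Kinf_less: "Kinf f \<Longrightarrow> 0 \<le> x \<Longrightarrow> x < y \<Longrightarrow> f x < f y"
  unfolding Kinf_def strict_mono_on_def by auto

lemma Kinf_zero: "Kinf f \<Longrightarrow> f 0 = 0"
  unfolding Kinf_def by auto

lemma Kinf_nonneg: "Kinf f \<Longrightarrow> 0 \<le> x \<Longrightarrow> 0 \<le> f x"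
  using Kinf_mono[of f 0 x] Kinf_zero[of f] by auto

text \<open>The arbitrary filter covers both sequences and right-hand limits at zero.\<close>

lemma Kinf_tendsto:
  assumes "Kinf f" "(x \<longlongrightarrow> y) F" "0 \<le> y" "eventually (\<lambda>n. 0 \<le> x n) F"
  shows "((\<lambda>n. f (x n)) \<longlongrightarrow> f y) F"
  using assms unfolding Kinf_def
  by (intro continuous_on_tendsto_compose[of "{0..}" f]) auto

lemma Kinf_scale_arg:
  assumes "Kinf f" "0 < c"
  shows "Kinf (\<lambda>r. f (c * r))"
  unfolding Kinf_def
proof (intro conjI allI)
  show "f (c * 0) = 0"
    using assms by (simp add: Kinf_zero)
  show "continuous_on {0..} (\<lambda>r. f (c * r))"
    using assms unfolding Kinf_def
    by (auto intro!: continuous_on_compose2[of "{0..}" f "{0..}" "\<lambda>r. c * r"] continuous_on_mult_left)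
  show "strict_mono_on {0..} (\<lambda>r. f (c * r))"
    using assms by (auto intro!: strict_mono_onI Kinf_less[OF assms(1)])
  show "\<exists>r\<ge>0. M < f (c * r)" for M
  proof -
    obtain r where "0 \<le> r" "M < f r"
      using assms unfolding Kinf_def by blast
    then show ?thesis
      using assms by (intro exI[of _ "r / c"]) auto
  qed
qed

lemma Kinf_scale:
  assumes "Kinf f" "0 < c"
  shows "Kinf (\<lambda>r. c * f r)"
  unfolding Kinf_def
proof (intro conjI allI)
  show "c * f 0 = 0"
    using assms by (simp add: Kinf_zero)
  show "continuous_on {0..} (\<lambda>r. c * f r)"
    using assms unfolding Kinf_def by (intro continuous_intros) auto
  show "strict_mono_on {0..} (\<lambda>r. c * f r)"
    using assms by (auto intro!: strict_mono_onI Kinf_less[OF assms(1)])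
  show "\<exists>r\<ge>0. M < c * f r" for M
  proof -
    obtain r where "0 \<le> r" "M / c < f r"
      using assms unfolding Kinf_def by blast
    then show ?thesis
      using assms by (intro exI[of _ r]) (auto simp: field_simps)
  qed
qed

lemma Kinf_id: "Kinf (\<lambda>r. r)"
proof -
  have "\<exists>r\<ge>0. M < r" for M :: real
    by (rule exI[of _ "\<bar>M\<bar> + 1"]) auto
  then show ?thesis
    unfolding Kinf_def by (auto intro!: strict_mono_onI)
qed

lemma Kinf_compose:
  assumes "Kinf f" "Kinf g"
  shows "Kinf (\<lambda>r. f (g r))"
  unfolding Kinf_def
proof (intro conjI allI)
  show "f (g 0) = 0"
    using assms by (simp add: Kinf_zero)
  show "continuous_on {0..} (\<lambda>r. f (g r))"
    using assms Kinf_nonneg[OF assms(2)] unfolding Kinf_def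
    by (intro continuous_on_compose2[of "{0..}" f "{0..}" g]) auto
  show "strict_mono_on {0..} (\<lambda>r. f (g r))"
    by (auto intro!: strict_mono_onI Kinf_less[OF assms(1)] Kinf_less[OF assms(2)]
        Kinf_nonneg[OF assms(2)])
  show "\<exists>r\<ge>0. M < f (g r)" for M
  proof -
    obtain r where r: "0 \<le> r" "M < f r"
      using assms unfolding Kinf_def by blast
    obtain q where "0 \<le> q" "r < g q"
      using assms unfolding Kinf_def by blast
    then show ?thesis
      using assms r Kinf_less[of f r "g q"] by (intro exI[of _ q]) auto
  qed
qed

text \<open>Extending by the identity to negative arguments makes \<open>f\<close> a bijection of the line, whose
  monotone inverse is continuous because its range is open.\<close>

lemma Kinf_inverse:
  assumes "Kinf f"
  obtains g where "Kinf g" "\<And>r. 0 \<le> r \<Longrightarrow> g (f r) = r"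
proof -
  define F where "F x = (if x < 0 then x else f x)" for x
  have strict: "strict_mono F"
  proof (rule strict_monoI)
    show "F x < F y" if "x < y" for x y
      using that Kinf_less[OF assms, of x y] Kinf_nonneg[OF assms, of y] by (auto simp: F_def)
  qed
  have "\<exists>x. F x = y" for y
  proof (cases "y < 0")
    case True
    then show ?thesis by (auto simp: F_def)
  next
    case False
    obtain r where r: "0 \<le> r" "y < f r"
      using assms unfolding Kinf_def by blast
    have "\<exists>x\<ge>0. x \<le> r \<and> f x = y"
      using False r assms unfolding Kinf_def
      by (intro IVT') (auto intro: continuous_on_subset)
    then obtain x where "0 \<le> x" "f x = y"
      by blast
    then show ?thesis
      by (intro exI[of _ x]) (simp add: F_def)
  qed
  then have "surj F" by (metis surj_def)
  define g where "g = inv F"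
  have gF: "g (F x) = x" for x
    using strict by (simp add: g_def strict_mono_imp_inj_on)
  have Fg: "F (g y) = y" for y
    using \<open>surj F\<close> by (simp add: g_def surj_f_inv_f)
  have g_less: "g x < g y \<longleftrightarrow> x < y" for x y
    using strict_mono_less[OF strict, of "g x" "g y"] by (simp add: Fg)
  have g_le: "g x \<le> g y \<longleftrightarrow> x \<le> y" for x y
    using g_less[of y x] by (simp add: not_less[symmetric])
  have gf: "g (f r) = r" if "0 \<le> r" for r
    using gF[of r] that by (simp add: F_def)
  have "range g = UNIV"
    by (metis gF surjI)
  then have cont: "continuous_on UNIV g"
    by (intro continuous_onI_mono) (auto simp: g_le)
  have "Kinf g"
    unfolding Kinf_def
  proof (intro conjI allI)
    show "g 0 = 0"
      using gf[of 0] Kinf_zero[OF assms] by simp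
    show "continuous_on {0..} g"
      using cont continuous_on_subset by blast
    show "strict_mono_on {0..} g"
      by (auto intro!: strict_mono_onI simp: g_less)
    show "\<exists>r\<ge>0. M < g r" for M
      using Kinf_nonneg[OF assms, of "\<bar>M\<bar> + 1"] gf[of "\<bar>M\<bar> + 1"]
      by (intro exI[of _ "f (\<bar>M\<bar> + 1)"]) auto
  qed
  then show ?thesis
    using that gf by blast
qed

subsection \<open>Lipschitz interpolation of decreasing sequences\<close>

text \<open>Interpolates a decreasing sequence at real times. Being a supremum of functions with Lipschitz
  constant \<open>B\<close> in \<open>\<tau>\<close>, it is Lipschitz uniformly in \<open>i\<close>; a slope \<open>B\<close> dominating the values of
  \<open>x\<close> keeps it between consecutive terms.\<close>

definition interp :: "real \<Rightarrow> (nat \<Rightarrow> 'i \<Rightarrow> real) \<Rightarrow> real \<Rightarrow> 'i \<Rightarrow> real" where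
  "interp B x \<tau> i = (SUP n. x n i - B * max 0 (\<tau> - real n))"

context
  fixes B :: real and x :: "nat \<Rightarrow> 'i \<Rightarrow> real"
  assumes dec: "decseq x"
    and nonneg: "\<And>n i. 0 \<le> x n i"
    and bound: "\<And>i. x 0 i \<le> B"
begin

lemma slope_nonneg: "0 \<le> B"
  using nonneg[of 0 undefined] bound[of undefined] by linarith

lemma seq_le: "m \<le> n \<Longrightarrow> x n i \<le> x m i"
  using decseqD[OF dec] by (auto simp: le_fun_def)

lemma interp_bdd_above: "bdd_above (range (\<lambda>n. x n i - B * max 0 (\<tau> - real n)))"
proof (rule bdd_aboveI2)
  show "x n i - B * max 0 (\<tau> - real n) \<le> x 0 i" for n
    using seq_le[of 0 n i] mult_nonneg_nonneg[OF slope_nonneg, of "max 0 (\<tau> - real n)"] by auto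
qed

lemma interp_upper: "x n i - B * max 0 (\<tau> - real n) \<le> interp B x \<tau> i"
  unfolding interp_def by (intro cSUP_upper interp_bdd_above) auto

text \<open>Together with \<open>interp_upper_bound\<close> this traps \<open>interp\<close> between
  \<open>x n\<close> and \<open>x m\<close> when \<open>real m \<le> \<tau> \<le> real n\<close>; at
  integer times it equals the corresponding term.\<close>

lemma interp_lower_bound: "\<tau> \<le> real n \<Longrightarrow> x n i \<le> interp B x \<tau> i"
  using interp_upper[of n i \<tau>] by simp

lemma interp_upper_bound:
  assumes "real m \<le> \<tau>"
  shows "interp B x \<tau> i \<le> x m i"
  unfolding interp_def
proof (rule cSUP_least)
  show "x n i - B * max 0 (\<tau> - real n) \<le> x m i" for n
  proof (cases "m \<le> n")
    case True
    then show ?thesis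
      using seq_le[of m n i] mult_nonneg_nonneg[OF slope_nonneg, of "max 0 (\<tau> - real n)"] by auto
  next
    case False
    \<comment> \<open>An index before \<open>m\<close> lies at least one unit before
      \<open>\<tau>\<close>; its penalty is at least \<open>B\<close>, so its contribution to the
      supremum is at most zero.\<close>
    then have "1 \<le> max 0 (\<tau> - real n)"
      using assms by linarith
    then have "B * 1 \<le> B * max 0 (\<tau> - real n)"
      by (intro mult_left_mono slope_nonneg)
    then show ?thesis
      using seq_le[of 0 n i] bound[of i] nonneg[of m i] by linarith
  qed
qed auto

lemma interp_antimono:
  assumes "\<tau> \<le> \<tau>'"
  shows "interp B x \<tau>' i \<le> interp B x \<tau> i"
  unfolding interp_def
proof (rule cSUP_mono)
  show "\<exists>m\<in>UNIV. x n i - B * max 0 (\<tau>' - real n) \<le> x m i - B * max 0 (\<tau> - real m)" for n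
    using assms by (intro bexI[of _ n] diff_left_mono mult_left_mono slope_nonneg) auto
qed (auto intro: interp_bdd_above)

lemma interp_Lipschitz:
  assumes "\<tau> \<le> \<tau>'"
  shows "interp B x \<tau> i \<le> interp B x \<tau>' i + B * (\<tau>' - \<tau>)"
  unfolding interp_def[of B x \<tau>]
proof (rule cSUP_least)
  show "x n i - B * max 0 (\<tau> - real n) \<le> interp B x \<tau>' i + B * (\<tau>' - \<tau>)" for n
  proof -
    have "B * max 0 (\<tau>' - real n) \<le> B * (max 0 (\<tau> - real n) + (\<tau>' - \<tau>))"
      using assms by (intro mult_left_mono slope_nonneg) auto
    then show ?thesis
      using interp_upper[of n i \<tau>'] by (simp add: algebra_simps)
  qed
qed auto

end

subsection \<open>The path of an operator with the MBI property\<close>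

text \<open>The properties of \<open>Gam_rho\<close> on which the construction of the path rests.
  Componentwise convergence is enough in \<open>T_tendsto\<close> because each component of the gain
  operator sees finitely many coordinates.\<close>

locale oplus_MBI_operator =
  fixes T :: "('i \<Rightarrow> real) \<Rightarrow> 'i \<Rightarrow> real" and \<phi> :: "real \<Rightarrow> real"
  assumes T_nonneg: "s \<in> linf_pos \<Longrightarrow> 0 \<le> T s i"
    and T_mono: "s \<in> linf_pos \<Longrightarrow> t \<in> linf_pos \<Longrightarrow> s \<le> t \<Longrightarrow> T s i \<le> T t i"
    and T_zero: "T (\<lambda>_. 0) i = 0"
    and T_tendsto: "(\<And>n. x n \<in> linf_pos) \<Longrightarrow> y \<in> linf_pos \<Longrightarrow> (\<And>i. (\<lambda>n. x n i) \<longlonglongrightarrow> y i)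
      \<Longrightarrow> (\<lambda>n. T (x n) i) \<longlonglongrightarrow> T y i"
    and Kinf_\<phi>: "Kinf \<phi>"
    and MBI: "s \<in> linf_pos \<Longrightarrow> b \<in> linf_pos \<Longrightarrow> (\<And>i. s i \<le> max (b i) (T s i))
      \<Longrightarrow> linf_norm s \<le> \<phi> (linf_norm b)"
begin

section \<open>Sub-solutions and the largest fixed point at a given level\<close>

definition subsol :: "real \<Rightarrow> ('i \<Rightarrow> real) set" where
  "subsol c = {s \<in> linf_pos. \<forall>i. s i \<le> max c (T s i)}"

definition top_sol :: "real \<Rightarrow> 'i \<Rightarrow> real" where
  "top_sol c i = (SUP s\<in>subsol c. s i)"

text \<open>The MBI property, applied with the constant family \<open>c\<close> as \<open>b\<close>,
  bounds all sub-solutions at once; this makes the supremum in \<open>top_sol\<close>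
  finite.\<close>

lemma subsol_le:
  assumes "0 \<le> c" "s \<in> subsol c"
  shows "s i \<le> \<phi> c"
proof -
  have "linf_norm s \<le> \<phi> (linf_norm (\<lambda>_::'i. c))"
    using assms by (intro MBI) (auto simp: subsol_def intro: linf_posI)
  then show ?thesis
    using assms le_linf_norm[of s i] by (auto simp: linf_norm_def subsol_def)
qed

text \<open>Supplies the nonemptiness that a real supremum needs, and the lower bound
  \<open>c\<close> for \<open>top_sol c\<close>.\<close>

lemma const_subsol: "0 \<le> c \<Longrightarrow> (\<lambda>_. c) \<in> subsol c"
  by (auto simp: subsol_def intro: linf_posI)

lemma subsol_le_top_sol: "0 \<le> c \<Longrightarrow> s \<in> subsol c \<Longrightarrow> s i \<le> top_sol c i"
  unfolding top_sol_def by (intro cSUP_upper bdd_aboveI2[where M = "\<phi> c"] subsol_le)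

lemma top_sol_least:
  assumes "0 \<le> c" "\<And>s. s \<in> subsol c \<Longrightarrow> s i \<le> B"
  shows "top_sol c i \<le> B"
  unfolding top_sol_def using assms const_subsol by (intro cSUP_least) blast+

lemma top_sol_ge: "0 \<le> c \<Longrightarrow> c \<le> top_sol c i"
  using subsol_le_top_sol[OF _ const_subsol] by auto

lemma top_sol_le: "0 \<le> c \<Longrightarrow> top_sol c i \<le> \<phi> c"
  by (intro top_sol_least subsol_le)

lemma top_sol_pos: "0 \<le> c \<Longrightarrow> top_sol c \<in> linf_pos"
  using top_sol_ge top_sol_le by (intro linf_posI) (auto intro: order_trans)

lemma top_sol_mono:
  assumes "0 \<le> c" "c \<le> d"
  shows "top_sol c i \<le> top_sol d i"
  using assms
  by (intro top_sol_least subsol_le_top_sol) (auto simp: subsol_def le_max_iff_disj intro: order_trans)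

text \<open>One half of the Knaster-Tarski argument: monotonicity of \<open>T\<close> carries the
  inequality from each sub-solution to their supremum.\<close>

lemma top_sol_subsol:
  assumes "0 \<le> c"
  shows "top_sol c \<in> subsol c"
proof -
  have "top_sol c i \<le> max c (T (top_sol c) i)" for i
  proof (rule top_sol_least[OF assms])
    fix s assume s: "s \<in> subsol c"
    have "T s i \<le> T (top_sol c) i"
      using s assms by (intro T_mono top_sol_pos) (auto simp: subsol_def le_fun_def subsol_le_top_sol)
    then show "s i \<le> max c (T (top_sol c) i)"
      using s by (auto simp: subsol_def le_max_iff_disj intro: order_trans)
  qed
  then show ?thesis
    using top_sol_pos[OF assms] by (simp add: subsol_def)
qed

text \<open>The truncation by \<open>\<phi> c + 1\<close> spares us from showing that \<open>T\<close> preserves boundedness.\<close>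

lemma top_sol_supersol:
  assumes "0 \<le> c"
  shows "max c (T (top_sol c) i) \<le> top_sol c i"
proof -
  define s where "s = (\<lambda>i. min (\<phi> c + 1) (max c (T (top_sol c) i)))"
  have "0 \<le> \<phi> c"
    by (rule Kinf_nonneg[OF Kinf_\<phi> assms])
  then have pos: "s \<in> linf_pos"
    using assms by (intro linf_posI[where B = "\<phi> c + 1"]) (auto simp: s_def)
  have ge: "top_sol c \<le> s"
    using top_sol_subsol[OF assms] top_sol_le[OF assms]
    by (simp add: s_def subsol_def le_fun_def add_increasing2)
  have "s i \<le> max c (T s i)" for i
  proof -
    have "s i \<le> max c (T (top_sol c) i)"
      by (simp add: s_def)
    also have "\<dots> \<le> max c (T s i)"
      by (intro max.mono order_refl T_mono top_sol_pos assms pos ge)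
    finally show ?thesis .
  qed
  then have "s \<in> subsol c"
    using pos by (simp add: subsol_def)
  then have "s i \<le> top_sol c i"
    by (rule subsol_le_top_sol[OF assms])
  \<comment> \<open>Since \<open>top_sol c i \<le> \<phi> c < \<phi> c + 1\<close>, the truncation
    in \<open>s\<close> is not active and the minimum is its other argument.\<close>
  then show ?thesis
    using top_sol_le[OF assms, of i] by (auto simp: s_def min_le_iff_disj)
qed

section \<open>Decreasing iterates from one level to half of it, and their interpolation\<close>

definition chain :: "real \<Rightarrow> nat \<Rightarrow> 'i \<Rightarrow> real" where
  "chain c n = ((\<lambda>s i. max c (T s i)) ^^ n) (top_sol (2 * c))"

lemma chain_0: "chain c 0 = top_sol (2 * c)"
  by (simp add: chain_def)

lemma chain_Suc: "chain c (Suc n) i = max c (T (chain c n) i)"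
  by (simp add: chain_def)

text \<open>The claims need a joint induction: the decrease keeps the iterates in
  \<open>linf_pos\<close>, where alone \<open>T_mono\<close> applies. The first step decreases
  because \<open>top_sol (2 * c)\<close> is a supersolution at level \<open>2 * c\<close>, hence
  also at level \<open>c\<close>.\<close>

lemma chain_props:
  assumes "0 \<le> c"
  shows "chain c n \<in> linf_pos \<and> top_sol c \<le> chain c n \<and> chain c (Suc n) \<le> chain c n"
proof (induction n)
  case 0
  have "max c (T (top_sol (2 * c)) i) \<le> top_sol (2 * c) i" for i
    using top_sol_supersol[of "2 * c" i] assms by auto
  then show ?case
    using assms by (auto simp: chain_0 chain_Suc le_fun_def intro!: top_sol_pos top_sol_mono)
next
  case (Suc n)
  have pos: "chain c (Suc n) \<in> linf_pos"
  proof (rule linf_pos_downward[of "chain c n"])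
    show "0 \<le> chain c (Suc n) i" for i
      using assms by (simp add: chain_Suc)
  qed (use Suc in auto)
  have "T (top_sol c) i \<le> T (chain c n) i" for i
    using Suc assms by (intro T_mono top_sol_pos) auto
  then have "top_sol c \<le> chain c (Suc n)"
    using top_sol_subsol[OF assms]
    by (fastforce simp: le_fun_def chain_Suc subsol_def le_max_iff_disj intro: order_trans)
  moreover have "T (chain c (Suc n)) i \<le> T (chain c n) i" for i
    using Suc pos by (intro T_mono) auto
  then have "chain c (Suc (Suc n)) i \<le> chain c (Suc n) i" for i
    unfolding chain_Suc[of c "Suc n"] chain_Suc[of c n]
    by (intro max.mono order_refl)
  ultimately show ?case
    using pos by (auto simp: le_fun_def)
qed

lemma chain_decseq: "0 \<le> c \<Longrightarrow> decseq (chain c)"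
  using chain_props by (intro decseq_SucI) auto

lemma chain_nonneg: "0 \<le> c \<Longrightarrow> 0 \<le> chain c n i"
  using chain_props[of c n] linf_pos_nonneg[of "chain c n" i] by simp

lemma chain_bound: "0 \<le> c \<Longrightarrow> chain c 0 i \<le> \<phi> (2 * c)"
  by (simp add: chain_0 top_sol_le)

text \<open>The limit is again a fixed point, so maximality of \<open>top_sol c\<close> identifies it.\<close>

lemma chain_tendsto:
  assumes "0 \<le> c"
  shows "(\<lambda>n. chain c n i) \<longlonglongrightarrow> top_sol c i"
proof -
  define y where "y i = lim (\<lambda>n. chain c n i)" for i
  have lim: "(\<lambda>n. chain c n i) \<longlonglongrightarrow> y i" for i
  proof -
    have "decseq (\<lambda>n. chain c n i)"
      using decseqD[OF chain_decseq[OF assms]] by (auto simp: decseq_def le_fun_def)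
    then have "convergent (\<lambda>n. chain c n i)"
      using chain_nonneg[OF assms] by (metis decseq_convergent convergentI)
    then show ?thesis
      by (simp add: y_def convergent_LIMSEQ_iff)
  qed
  have y_le: "y i \<le> chain c 0 i" for i
    using decseqD[OF chain_decseq[OF assms], of 0]
    by (intro LIMSEQ_le_const2[OF lim]) (auto simp: le_fun_def)
  have y_ge: "top_sol c i \<le> y i" for i
    using chain_props[OF assms] by (intro LIMSEQ_le_const[OF lim]) (auto simp: le_fun_def)
  have pos: "y \<in> linf_pos"
    using y_le chain_bound[OF assms] y_ge top_sol_ge[OF assms] assms
    by (intro linf_posI[where B = "\<phi> (2 * c)"]) (meson order_trans)+
  have "(\<lambda>n. T (chain c n) i) \<longlonglongrightarrow> T y i" for i
    using chain_props[OF assms] pos lim by (intro T_tendsto) auto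
  then have "(\<lambda>n. chain c (Suc n) i) \<longlonglongrightarrow> max c (T y i)" for i
    unfolding chain_Suc by (intro tendsto_intros)
  then have "y i = max c (T y i)" for i
    using LIMSEQ_Suc[OF lim] LIMSEQ_unique by blast
  then have "y \<in> subsol c"
    using pos by (simp add: subsol_def)
  then have "y i = top_sol c i" for i
    using subsol_le_top_sol[OF assms] y_ge by (intro antisym) auto
  then show ?thesis
    using lim by simp
qed

text \<open>The time change \<open>c / (r - c) - 1\<close> falls from infinity at \<open>c\<close>
  to zero at \<open>2 * c\<close>, so growing \<open>r\<close> runs the decreasing chain backwards,
  from its limit \<open>top_sol c\<close> up to its start \<open>top_sol (2 * c)\<close>.\<close>

definition seg :: "real \<Rightarrow> real \<Rightarrow> 'i \<Rightarrow> real" where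
  "seg c r = interp (\<phi> (2 * c)) (chain c) (c / (r - c) - 1)"

context
  fixes c :: real
  assumes c_pos: "0 < c"
begin

lemmas chain_interp =
  chain_decseq[OF less_imp_le[OF c_pos]]
  chain_nonneg[OF less_imp_le[OF c_pos]]
  chain_bound[OF less_imp_le[OF c_pos]]

lemma seg_time_nonneg: "c < r \<Longrightarrow> r \<le> 2 * c \<Longrightarrow> 0 \<le> c / (r - c) - 1"
  by (simp add: field_simps)

lemma seg_le: "c < r \<Longrightarrow> r \<le> 2 * c \<Longrightarrow> seg c r i \<le> top_sol (2 * c) i"
  using interp_upper_bound[OF chain_interp, of 0 "c / (r - c) - 1" i] seg_time_nonneg[of r]
  by (simp add: seg_def chain_0)

lemma seg_ge: "c < r \<Longrightarrow> r \<le> 2 * c \<Longrightarrow> top_sol c i \<le> seg c r i"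
  using interp_lower_bound[OF chain_interp, of "c / (r - c) - 1" "nat \<lceil>c / (r - c) - 1\<rceil>" i]
    chain_props[of c "nat \<lceil>c / (r - c) - 1\<rceil>"] seg_time_nonneg[of r] c_pos
  by (auto simp: seg_def le_fun_def real_nat_ceiling_ge intro: order_trans)

lemma seg_end: "seg c (2 * c) i = top_sol (2 * c) i"
  using interp_upper_bound[OF chain_interp, of 0 0 i] interp_lower_bound[OF chain_interp, of 0 0 i]
    c_pos by (simp add: seg_def chain_0)

lemma seg_mono:
  assumes "c < r" "r \<le> r'"
  shows "seg c r i \<le> seg c r' i"
  unfolding seg_def
  using assms c_pos by (intro interp_antimono[OF chain_interp] diff_right_mono frac_le) auto

lemma seg_Psi:
  assumes "c < r" "r \<le> 2 * c"
  shows "seg c r \<in> Psi T"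
proof -
  \<comment> \<open>With this \<open>n\<close> the segment lies between the consecutive iterates
    \<open>chain c (Suc n)\<close> and \<open>chain c n\<close>.\<close>
  define n where "n = nat \<lfloor>c / (r - c) - 1\<rfloor>"
  have n: "real n \<le> c / (r - c) - 1" "c / (r - c) - 1 \<le> real (Suc n)"
    using seg_time_nonneg[OF assms] unfolding n_def by linarith+
  have upper: "seg c r i \<le> chain c n i" and lower: "chain c (Suc n) i \<le> seg c r i" for i
    using interp_upper_bound[OF chain_interp n(1)] interp_lower_bound[OF chain_interp n(2)]
    by (auto simp: seg_def)
  have pos: "seg c r \<in> linf_pos"
  proof (rule linf_pos_downward[of "chain c n"])
    show "0 \<le> seg c r i" for i
      using order_trans[OF chain_nonneg lower] c_pos by simp
  qed (use upper chain_props[of c n] c_pos in \<open>auto simp: le_fun_def\<close>)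
  have "T (seg c r) i \<le> seg c r i" for i
  proof -
    have "T (seg c r) i \<le> T (chain c n) i"
      using chain_props[of c n] c_pos pos upper by (intro T_mono) (auto simp: le_fun_def)
    also have "\<dots> \<le> chain c (Suc n) i"
      by (simp add: chain_Suc)
    finally show ?thesis
      using lower[of i] by simp
  qed
  then show ?thesis
    using pos by (simp add: Psi_def)
qed

text \<open>The Lipschitz constant in time is the same for all \<open>i\<close>, and the time change
  is continuous away from \<open>c\<close>. The two-sided neighbourhood serves continuity from below
  and, inside a dyadic interval, from above.\<close>

lemma seg_uniform_tendsto:
  assumes "c < r0" "0 < e"
  shows "\<forall>\<^sub>F r in nhds r0. \<forall>i. \<bar>seg c r i - seg c r0 i\<bar> < e"
proof -
  define t where "t r = c / (r - c) - 1" for r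
  define B where "B = \<phi> (2 * c)"
  have B: "0 \<le> B"
    using Kinf_nonneg[OF Kinf_\<phi>, of "2 * c"] c_pos by (simp add: B_def)
  have "isCont (\<lambda>r. B * \<bar>t r - t r0\<bar>) r0"
    unfolding t_def using assms by (intro continuous_intros) auto
  then have "((\<lambda>r. B * \<bar>t r - t r0\<bar>) \<longlongrightarrow> 0) (nhds r0)"
    using tendsto_at_iff_tendsto_nhds[of "\<lambda>r. B * \<bar>t r - t r0\<bar>" r0] by (simp add: isCont_def)
  then have "\<forall>\<^sub>F r in nhds r0. B * \<bar>t r - t r0\<bar> < e"
    using assms(2) by (rule order_tendstoD)
  moreover have "\<bar>seg c r i - seg c r0 i\<bar> \<le> B * \<bar>t r - t r0\<bar>" for r i
    using interp_Lipschitz[OF chain_interp, of "t r" "t r0" i]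
      interp_Lipschitz[OF chain_interp, of "t r0" "t r" i]
      interp_antimono[OF chain_interp, of "t r" "t r0" i]
      interp_antimono[OF chain_interp, of "t r0" "t r" i]
    by (cases "t r \<le> t r0") (auto simp: seg_def t_def[symmetric] B_def[symmetric])
  ultimately show ?thesis
    by (auto elim!: eventually_mono intro: le_less_trans)
qed

text \<open>At the left end point the chain converges only componentwise, so \<open>r\<close>
  depends on \<open>i\<close>.\<close>

lemma seg_start:
  assumes "0 < e"
  obtains r where "c < r" "r \<le> 2 * c" "seg c r i < top_sol c i + e"
proof -
  have "\<forall>\<^sub>F n in sequentially. chain c n i < top_sol c i + e"
    using chain_tendsto[of c i] c_pos assms by (intro order_tendstoD) auto
  then obtain n where n: "chain c n i < top_sol c i + e"
    by (auto simp: eventually_sequentially)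
  \<comment> \<open>Chosen so that the time change takes exactly the value \<open>n\<close>.\<close>
  define r where "r = c + c / (real n + 1)"
  have r: "c < r" "r \<le> 2 * c" and "c / (r - c) - 1 = real n"
    using c_pos by (auto simp: r_def divide_le_eq mult_left_le add_pos_nonneg)
  then have "seg c r i \<le> chain c n i"
    using interp_upper_bound[OF chain_interp, of n "real n" i] by (simp add: seg_def)
  then show ?thesis
    using that r n by fastforce
qed

end

section \<open>Gluing the segments over dyadic intervals\<close>

definition dy :: "real \<Rightarrow> real" where
  "dy r = 2 powr (of_int \<lceil>log 2 r\<rceil> - 1)"

definition path :: "real \<Rightarrow> 'i \<Rightarrow> real" where
  "path r = (if r \<le> 0 then (\<lambda>_. 0) else seg (dy r) r)"

lemma dy_pos: "0 < dy r"
  by (simp add: dy_def)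

text \<open>Thus \<open>dy r\<close> is the largest power of two strictly below \<open>r\<close>.
  The ceiling makes a power of two the right end point of its interval, which is what continuity
  from below requires.\<close>

lemma dy_bounds:
  assumes "0 < r"
  shows "dy r < r" "r \<le> 2 * dy r"
proof -
  have "2 powr (of_int \<lceil>log 2 r\<rceil> - 1) < 2 powr (log 2 r)"
    by (intro powr_less_mono) linarith+
  then show "dy r < r"
    using assms by (simp add: dy_def)
  have "2 powr (log 2 r) \<le> 2 powr (1 + (of_int \<lceil>log 2 r\<rceil> - 1))"
    by (intro powr_mono) linarith+
  then show "r \<le> 2 * dy r"
    using assms unfolding powr_add dy_def by simp
qed

text \<open>The ceiling of the logarithm is constant on each half-open dyadic interval, so near
  \<open>r0\<close> the path can be followed along a single segment.\<close>

lemma dy_unique: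
  assumes "0 < r0" "dy r0 < r" "r \<le> 2 * dy r0"
  shows "dy r = dy r0"
proof -
  define k where "k = \<lceil>log 2 r0\<rceil>"
  have "0 < r"
    using assms dy_pos[of r0] by linarith
  have "2 powr (of_int k - 1) < r" "r \<le> 2 powr (1 + (of_int k - 1))"
    using assms unfolding powr_add by (simp_all add: dy_def k_def)
  then have "of_int k - 1 < log 2 r" "log 2 r \<le> of_int k"
    using \<open>0 < r\<close> by (simp_all add: less_log_iff log_le_iff)
  then have "\<lceil>log 2 r\<rceil> = k"
    by (intro ceiling_unique)
  then show ?thesis
    by (simp add: dy_def k_def)
qed

lemma dy_step:
  assumes "0 < r" "0 < r'" "dy r < dy r'"
  shows "2 * dy r \<le> dy r'"
proof -
  have "\<lceil>log 2 r\<rceil> < \<lceil>log 2 r'\<rceil>"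
    using assms(3) by (simp add: dy_def)
  then have "2 powr (1 + (of_int \<lceil>log 2 r\<rceil> - 1)) \<le> (2 :: real) powr (of_int \<lceil>log 2 r'\<rceil> - 1)"
    by (intro powr_mono) linarith+
  then show ?thesis
    unfolding powr_add by (simp add: dy_def)
qed

text \<open>With \<open>c = dy r\<close>, the segment lies between \<open>top_sol c\<close>, which
  is at least \<open>c\<close> and so at least \<open>r / 2\<close>, and
  \<open>top_sol (2 * c)\<close>, which is at most \<open>\<phi> (2 * c)\<close> and so at most
  \<open>\<phi> (2 * r)\<close>.\<close>

lemma path_bounds:
  assumes "0 \<le> r"
  shows "r / 2 \<le> path r i" "path r i \<le> \<phi> (2 * r)"
proof -
  have "r / 2 \<le> path r i \<and> path r i \<le> \<phi> (2 * r)"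
  proof (cases "r = 0")
    case True
    then show ?thesis
      by (simp add: path_def Kinf_zero[OF Kinf_\<phi>])
  next
    case False
    then have r: "0 < r"
      using assms by simp
    have "\<phi> (2 * dy r) \<le> \<phi> (2 * r)"
      using dy_bounds[OF r] dy_pos[of r] by (intro Kinf_mono[OF Kinf_\<phi>]) auto
    then show ?thesis
      using dy_bounds[OF r] dy_pos[of r] r seg_ge[OF dy_pos dy_bounds[OF r], of i]
        seg_le[OF dy_pos dy_bounds[OF r], of i] top_sol_le[of "2 * dy r" i] top_sol_ge[of "dy r" i]
      by (auto simp: path_def)
  qed
  then show "r / 2 \<le> path r i" "path r i \<le> \<phi> (2 * r)"
    by auto
qed

lemma path_Psi:
  assumes "0 \<le> r"
  shows "path r \<in> Psi T"
proof (cases "r = 0")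
  case True
  then show ?thesis
    by (auto simp: path_def Psi_def T_zero intro: linf_posI)
next
  case False
  then show ?thesis
    using assms seg_Psi[OF dy_pos dy_bounds, of r] by (simp add: path_def)
qed

lemma path_mono:
  assumes "0 \<le> r" "r \<le> r'"
  shows "path r i \<le> path r' i"
proof (cases "r = 0")
  case True
  then show ?thesis
    using path_bounds(1)[of r' i] assms by (auto simp: path_def)
next
  case False
  then have r: "0 < r" "0 < r'"
    using assms by auto
  have "dy r \<le> dy r'"
    using assms r by (auto simp: dy_def intro!: ceiling_mono)
  then consider "dy r = dy r'" | "dy r < dy r'"
    by linarith
  then show ?thesis
  proof cases
    case 1
    then show ?thesis
      using seg_mono[OF dy_pos dy_bounds(1)[OF r(1)] assms(2), of i] r by (simp add: path_def)
  next
    case 2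
    \<comment> \<open>Different intervals are separated by the fixed points at their end
      points.\<close>
    have "seg (dy r) r i \<le> top_sol (2 * dy r) i"
      by (intro seg_le dy_pos dy_bounds r)
    also have "\<dots> \<le> top_sol (dy r') i"
      using dy_step[OF r 2] dy_pos[of r] by (intro top_sol_mono) auto
    also have "\<dots> \<le> seg (dy r') r' i"
      by (intro seg_ge dy_pos dy_bounds r)
    finally show ?thesis
      using r by (simp add: path_def)
  qed
qed

text \<open>The dyadic intervals are open on the left, so points just below a positive
  \<open>r0\<close> use the same segment as \<open>r0\<close>.\<close>

lemma path_cont_below:
  assumes "0 \<le> r0" "0 < e"
  shows "\<forall>\<^sub>F r in nhds r0. 0 \<le> r \<and> r \<le> r0 \<longrightarrow> (\<forall>i. \<bar>path r i - path r0 i\<bar> < e)"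
proof (cases "r0 = 0")
  case True
  then show ?thesis
    using assms by (intro always_eventually) (auto simp: path_def)
next
  case False
  then have r0: "0 < r0"
    using assms by simp
  have "\<forall>\<^sub>F r in nhds r0. dy r0 < r"
    using dy_bounds[OF r0] by (simp add: eventually_nhds_in_open[of "{dy r0<..}", simplified])
  with seg_uniform_tendsto[OF dy_pos dy_bounds(1)[OF r0] assms(2)] show ?thesis
  proof eventually_elim
    case (elim r)
    show ?case
    proof clarify
      fix i assume "0 \<le> r" "r \<le> r0"
      then have "dy r = dy r0" "0 < r"
        using elim dy_bounds[OF r0] dy_pos[of r0] r0 by (auto intro!: dy_unique)
      then show "\<bar>path r i - path r0 i\<bar> < e"
        using elim r0 by (simp add: path_def)
    qed
  qed
qed

text \<open>As the path is monotone, one point beyond \<open>r0\<close> controls the component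
  \<open>i\<close> on the whole gap. The cases are zero, the interior of a dyadic interval, and a
  power of two.\<close>

lemma path_cont_above:
  assumes "0 \<le> r0" "0 < e"
  obtains r where "r0 < r" "path r i < path r0 i + e"
proof (cases "r0 = 0")
  case True
  have "((\<lambda>r. \<phi> (2 * r)) \<longlongrightarrow> \<phi> (2 * 0)) (at_right 0)"
    by (intro Kinf_tendsto[OF Kinf_\<phi>] tendsto_intros)
      (auto simp: eventually_at_right_less eventually_at_filter)
  then have "\<forall>\<^sub>F r in at_right 0. \<phi> (2 * r) < e"
    using assms Kinf_zero[OF Kinf_\<phi>] by (intro order_tendstoD) auto
  then obtain d where d: "0 < d" "\<And>r. 0 < r \<Longrightarrow> r < d \<Longrightarrow> \<phi> (2 * r) < e"
    by (auto simp: eventually_at_right_field)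
  show ?thesis
    using that[of "d / 2"] d(1) d(2)[of "d / 2"] path_bounds(2)[of "d / 2" i] True
    by (auto simp: path_def)
next
  case False
  then have r0: "0 < r0"
    using assms by simp
  show ?thesis
  proof (cases "r0 < 2 * dy r0")
    case True
    have "\<forall>\<^sub>F r in nhds r0. r < 2 * dy r0"
      using True by (simp add: eventually_nhds_in_open[of "{..<2 * dy r0}", simplified])
    with seg_uniform_tendsto[OF dy_pos dy_bounds(1)[OF r0] assms(2)]
    have "\<forall>\<^sub>F r in nhds r0. (\<forall>i. \<bar>seg (dy r0) r i - seg (dy r0) r0 i\<bar> < e) \<and> r < 2 * dy r0"
      by (rule eventually_conj)
    then obtain d where d: "0 < d" "\<And>r. dist r r0 < d \<Longrightarrow>
      (\<forall>i. \<bar>seg (dy r0) r i - seg (dy r0) r0 i\<bar> < e) \<and> r < 2 * dy r0"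
      unfolding eventually_nhds_metric by blast
    define r where "r = r0 + d / 2"
    have r: "r0 < r" "r < 2 * dy r0" "\<bar>seg (dy r0) r i - seg (dy r0) r0 i\<bar> < e"
      using d(1) d(2)[of r] by (auto simp: r_def dist_real_def)
    then have "dy r = dy r0"
      using dy_bounds[OF r0] r0 by (intro dy_unique) auto
    then show ?thesis
      using that[of r] r r0 by (simp add: path_def abs_less_iff)
  next
    case False
    then have eq: "r0 = 2 * dy r0"
      using dy_bounds[OF r0] by simp
    \<comment> \<open>Beyond a power of two the path switches to the next segment, which starts from
      \<open>top_sol r0\<close>, the value of the path at \<open>r0\<close>.\<close>
    obtain r where r: "r0 < r" "r \<le> 2 * r0" "seg r0 r i < top_sol r0 i + e"
      using seg_start[OF r0 assms(2)] by blast
    have "dy (2 * r0) = r0"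
    proof -
      have "log 2 (2 * r0) = 1 + log 2 r0"
        using r0 by (simp add: log_mult)
      then have "\<lceil>log 2 (2 * r0)\<rceil> = 1 + \<lceil>log 2 r0\<rceil>"
        by linarith
      then have "dy (2 * r0) = 2 powr (1 + (of_int \<lceil>log 2 r0\<rceil> - 1))"
        by (simp add: dy_def)
      then show ?thesis
        using eq unfolding powr_add by (simp add: dy_def)
    qed
    then have "dy r = r0"
      using dy_unique[of "2 * r0" r] r r0 by simp
    moreover have "path r0 i = top_sol r0 i"
      using seg_end[OF dy_pos[of r0], of i] eq r0 by (simp add: path_def)
    ultimately show ?thesis
      using that[of r] r r0 by (simp add: path_def)
  qed
qed

lemma path_norm_tendsto_below:
  assumes "0 \<le> r0" "\<And>n. 0 \<le> rs n \<and> rs n \<le> r0" "rs \<longlonglongrightarrow> r0"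
  shows "(\<lambda>n. linf_norm (\<lambda>i. path (rs n) i - path r0 i)) \<longlonglongrightarrow> 0"
proof (rule tendstoI)
  fix e :: real assume e: "0 < e"
  \<comment> \<open>Half of \<open>e\<close>, because strict bounds on the components give only a
    weak bound on the supremum.\<close>
  have "\<forall>\<^sub>F n in sequentially. \<forall>i. \<bar>path (rs n) i - path r0 i\<bar> < e / 2"
    using filterlim_iff[THEN iffD1, OF assms(3), rule_format, OF path_cont_below[of r0 "e / 2"]]
      assms e by simp
  then show "\<forall>\<^sub>F n in sequentially. dist (linf_norm (\<lambda>i. path (rs n) i - path r0 i)) 0 < e"
  proof eventually_elim
    case (elim n)
    then have "linf_norm (\<lambda>i. path (rs n) i - path r0 i) \<le> e / 2"
      by (intro linf_norm_le less_imp_le) auto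
    moreover have "0 \<le> linf_norm (\<lambda>i. path (rs n) i - path r0 i)"
      using abs_diff_le_linf_norm[of "path (rs n)" "path r0" undefined] path_Psi[of "rs n"]
        path_Psi[of r0] assms by (auto simp: Psi_def)
    ultimately show ?case
      using e by simp
  qed
qed

text \<open>A convergent sequence of arguments is bounded, which bounds the norms; each component is
  squeezed between its values at \<open>r0\<close> and at the point from
  \<open>path_cont_above\<close>.\<close>

lemma path_weak_star_tendsto_above:
  assumes "0 \<le> r0" "\<And>n. r0 \<le> rs n" "rs \<longlonglongrightarrow> r0"
  shows "weak_star_tendsto (\<lambda>n. path (rs n)) (path r0)"
  unfolding weak_star_tendsto_def
proof (intro conjI allI)
  obtain B where B: "\<And>n. rs n \<le> B"
    using convergent_imp_Bseq[of rs] assms(3)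
    by (metis BseqE convergentI abs_le_D1 real_norm_def)
  have "linf_norm (path (rs n)) \<le> \<phi> (2 * B)" for n
  proof (rule linf_norm_le)
    have "0 \<le> rs n"
      using assms(1) assms(2)[of n] by simp
    then show "\<bar>path (rs n) i\<bar> \<le> \<phi> (2 * B)" for i
      using path_bounds[of "rs n" i] B[of n] Kinf_mono[OF Kinf_\<phi>, of "2 * rs n" "2 * B"] by auto
  qed
  then show "\<exists>B. \<forall>n. linf_norm (path (rs n)) \<le> B"
    by blast
  show "(\<lambda>n. path (rs n) i) \<longlonglongrightarrow> path r0 i" for i
  proof (rule tendstoI)
    fix e :: real assume "0 < e"
    then obtain r where r: "r0 < r" "path r i < path r0 i + e"
      using path_cont_above[OF assms(1)] by blast
    have "\<forall>\<^sub>F n in sequentially. rs n < r"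
      using assms(3) r(1) by (rule order_tendstoD)
    then show "\<forall>\<^sub>F n in sequentially. dist (path (rs n) i) (path r0 i) < e"
    proof eventually_elim
      case (elim n)
      then show ?case
        using path_mono[of r0 "rs n" i] path_mono[of "rs n" r i] r(2) assms(1)
          assms(2)[of n] by (auto simp: dist_real_def)
    qed
  qed
qed

end

subsection \<open>Gain operators\<close>

context
  fixes II :: "'i \<Rightarrow> 'i set" and gam :: "'i \<Rightarrow> 'i \<Rightarrow> real \<Rightarrow> real"
    and mu :: "'i \<Rightarrow> ('i \<Rightarrow> real) \<Rightarrow> ereal"
  assumes gain: "gain_operator II gam mu"
begin

abbreviation gain_arg :: "('i \<Rightarrow> real) \<Rightarrow> 'i \<Rightarrow> 'i \<Rightarrow> real" where
  "gain_arg s i \<equiv> \<lambda>j. if j \<in> II i then gam i j (s j) else 0"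

lemma finite_neighbours: "finite (II i)"
  using gain unfolding gain_operator_def by auto

lemma gam_Kinf: "j \<in> II i \<Longrightarrow> Kinf (gam i j)"
  using gain unfolding gain_operator_def by auto

lemma mu_nonneg: "s \<in> linf_pos \<Longrightarrow> 0 \<le> mu i s"
  using gain unfolding gain_operator_def by auto

lemma mu_zero: "mu i (\<lambda>_. 0) = 0"
  using gain unfolding gain_operator_def by auto

lemma mu_mono: "s \<in> linf_pos \<Longrightarrow> t \<in> linf_pos \<Longrightarrow> s \<le> t \<Longrightarrow> mu i s \<le> mu i t"
  using gain unfolding gain_operator_def le_fun_def by auto

lemma mu_finite: "finite J \<Longrightarrow> s \<in> linf_pos \<Longrightarrow> (\<And>k. k \<notin> J \<Longrightarrow> s k = 0) \<Longrightarrow> mu i s \<noteq> \<infinity>"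
  using gain unfolding gain_operator_def by blast

lemma mu_cont:
  assumes "finite J" "s \<in> linf_pos" "\<And>k. k \<notin> J \<Longrightarrow> s k = 0" "0 < e"
  obtains d where "0 < d" "\<And>s'. s' \<in> linf_pos \<Longrightarrow> (\<And>k. k \<notin> J \<Longrightarrow> s' k = 0) \<Longrightarrow>
    linf_norm (\<lambda>k. s' k - s k) < d \<Longrightarrow> \<bar>real_of_ereal (mu i s') - real_of_ereal (mu i s)\<bar> < e"
proof -
  have "\<forall>i J. finite J \<longrightarrow>
        (\<forall>s\<in>linf_pos. (\<forall>k. k \<notin> J \<longrightarrow> s k = 0) \<longrightarrow>
           mu i s \<noteq> \<infinity> \<and>
           (\<forall>\<epsilon>>0. \<exists>\<delta>>0. \<forall>s'\<in>linf_pos. (\<forall>k. k \<notin> J \<longrightarrow> s' k = 0) \<longrightarrow>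
               linf_norm (\<lambda>k. s' k - s k) < \<delta> \<longrightarrow>
               \<bar>real_of_ereal (mu i s') - real_of_ereal (mu i s)\<bar> < \<epsilon>))"
    using gain unfolding gain_operator_def by (elim conjE)
  moreover have "\<forall>k. k \<notin> J \<longrightarrow> s k = 0"
    using assms(3) by blast
  ultimately have "\<forall>\<epsilon>>0. \<exists>\<delta>>0. \<forall>s'\<in>linf_pos. (\<forall>k. k \<notin> J \<longrightarrow> s' k = 0) \<longrightarrow>
      linf_norm (\<lambda>k. s' k - s k) < \<delta> \<longrightarrow>
      \<bar>real_of_ereal (mu i s') - real_of_ereal (mu i s)\<bar> < \<epsilon>"
    using assms(1,2) by simp
  then obtain d where "0 < d" "\<forall>s'\<in>linf_pos. (\<forall>k. k \<notin> J \<longrightarrow> s' k = 0) \<longrightarrow>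
      linf_norm (\<lambda>k. s' k - s k) < d \<longrightarrow> \<bar>real_of_ereal (mu i s') - real_of_ereal (mu i s)\<bar> < e"
    using assms(4) by blast
  then show ?thesis
    by (intro that[of d]) simp_all
qed

lemma gain_arg_pos:
  assumes "s \<in> linf_pos"
  shows "gain_arg s i \<in> linf_pos"
proof -
  have nn: "0 \<le> gain_arg s i j" for j
    using Kinf_nonneg[OF gam_Kinf, of j i "s j"] linf_pos_nonneg[OF assms, of j] by simp
  \<comment> \<open>Finitely many neighbours: the sum of their values is a crude bound on the
    family.\<close>
  have "gain_arg s i j \<le> (\<Sum>j\<in>II i. gain_arg s i j)" for j
  proof (cases "j \<in> II i")
    case True
    then show ?thesis
      by (rule member_le_sum) (rule nn, rule finite_neighbours)
  next
    case False
    then show ?thesis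
      using sum_nonneg[of "II i" "gain_arg s i", OF nn] by simp
  qed
  with nn show ?thesis
    by (rule linf_posI)
qed

text \<open>As \<open>real_of_ereal\<close> sends infinity to zero, finiteness is what lets
  inequalities pass from \<open>mu\<close> to \<open>Gam\<close>.\<close>

lemma mu_gain_arg_finite: "s \<in> linf_pos \<Longrightarrow> \<bar>mu i (gain_arg s i)\<bar> \<noteq> \<infinity>"
  using mu_finite[OF finite_neighbours[of i] gain_arg_pos, of s i i] mu_nonneg[OF gain_arg_pos, of s i i]
  by auto

lemma Gam_nonneg: "s \<in> linf_pos \<Longrightarrow> 0 \<le> Gam II gam mu s i"
  unfolding Gam_def by (intro real_of_ereal_pos mu_nonneg gain_arg_pos)

lemma Gam_mono:
  assumes "s \<in> linf_pos" "t \<in> linf_pos" "s \<le> t"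
  shows "Gam II gam mu s i \<le> Gam II gam mu t i"
proof -
  have "gain_arg s i \<le> gain_arg t i"
  proof (rule le_funI)
    show "gain_arg s i j \<le> gain_arg t i j" for j
      using Kinf_mono[OF gam_Kinf, of j i "s j" "t j"] linf_pos_nonneg[OF assms(1), of j]
        le_funD[OF assms(3), of j] by simp
  qed
  then have "mu i (gain_arg s i) \<le> mu i (gain_arg t i)"
    by (intro mu_mono gain_arg_pos assms)
  then show ?thesis
    using mu_gain_arg_finite[OF assms(2), of i] mu_nonneg[OF gain_arg_pos[OF assms(1)], of i i]
    unfolding Gam_def by (intro real_of_ereal_positive_mono) auto
qed

lemma Gam_zero: "Gam II gam mu (\<lambda>_. 0) i = 0"
proof -
  have "gain_arg (\<lambda>_. 0) i = (\<lambda>_. 0)"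
    using Kinf_zero[OF gam_Kinf] by fastforce
  then show ?thesis
    by (simp add: Gam_def mu_zero)
qed

text \<open>On the finite set \<open>II i\<close>, componentwise convergence of the gain arguments
  is norm convergence, so (M3) applies.\<close>

lemma Gam_tendsto:
  assumes "\<And>n. x n \<in> linf_pos" "y \<in> linf_pos" "\<And>i. (\<lambda>n. x n i) \<longlonglongrightarrow> y i"
  shows "(\<lambda>n. Gam II gam mu (x n) i) \<longlonglongrightarrow> Gam II gam mu y i"
proof (rule tendstoI)
  fix e :: real assume "0 < e"
  then obtain d where d: "0 < d" "\<And>s'. s' \<in> linf_pos \<Longrightarrow> (\<And>k. k \<notin> II i \<Longrightarrow> s' k = 0) \<Longrightarrow>
    linf_norm (\<lambda>k. s' k - gain_arg y i k) < d \<Longrightarrow>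
    \<bar>real_of_ereal (mu i s') - real_of_ereal (mu i (gain_arg y i))\<bar> < e"
    using mu_cont[OF finite_neighbours[of i] gain_arg_pos[OF assms(2)], of i e i] by auto
  have "\<forall>\<^sub>F n in sequentially. \<bar>gam i j (x n j) - gam i j (y j)\<bar> < d / 2" if "j \<in> II i" for j
  proof -
    have "(\<lambda>n. gam i j (x n j)) \<longlonglongrightarrow> gam i j (y j)"
      using assms by (intro Kinf_tendsto[OF gam_Kinf[OF that]]) (auto simp: linf_pos_nonneg)
    from tendstoD[OF this, of "d / 2"] show ?thesis
      using d(1) by (simp add: dist_real_def)
  qed
  then have "\<forall>\<^sub>F n in sequentially. \<forall>j\<in>II i. \<bar>gam i j (x n j) - gam i j (y j)\<bar> < d / 2"
    by (intro eventually_ball_finite finite_neighbours) auto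
  then show "\<forall>\<^sub>F n in sequentially. dist (Gam II gam mu (x n) i) (Gam II gam mu y i) < e"
  proof eventually_elim
    case (elim n)
    have "linf_norm (\<lambda>k. gain_arg (x n) i k - gain_arg y i k) \<le> d / 2"
      using elim d(1) by (intro linf_norm_le) (auto intro: less_imp_le)
    then show ?case
      using d(1) d(2)[OF gain_arg_pos[OF assms(1)[of n]]] by (simp add: Gam_def dist_real_def)
  qed
qed

lemma MBI_operator_Gam_rho:
  assumes "Kinf \<rho>" "Kinf \<phi>"
    and "\<And>s b. s \<in> linf_pos \<Longrightarrow> b \<in> linf_pos \<Longrightarrow>
      (\<And>i. s i \<le> max (b i) (Gam_rho II gam mu \<rho> s i)) \<Longrightarrow> linf_norm s \<le> \<phi> (linf_norm b)"
  shows "oplus_MBI_operator (Gam_rho II gam mu \<rho>) \<phi>"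
proof
  show "0 \<le> Gam_rho II gam mu \<rho> s i" if "s \<in> linf_pos" for s i
    using Gam_nonneg[OF that] Kinf_nonneg[OF assms(1)] by (simp add: Gam_rho_def)
  show "Gam_rho II gam mu \<rho> s i \<le> Gam_rho II gam mu \<rho> t i"
    if "s \<in> linf_pos" "t \<in> linf_pos" "s \<le> t" for s t i
    using Gam_mono[OF that] Gam_nonneg[OF that(1)] Kinf_mono[OF assms(1)]
    by (simp add: Gam_rho_def add_mono)
  show "Gam_rho II gam mu \<rho> (\<lambda>_. 0) i = 0" for i
    by (simp add: Gam_rho_def Gam_zero Kinf_zero[OF assms(1)])
  show "(\<lambda>n. Gam_rho II gam mu \<rho> (x n) i) \<longlonglongrightarrow> Gam_rho II gam mu \<rho> y i"
    if "\<And>n. x n \<in> linf_pos" "y \<in> linf_pos" "\<And>i. (\<lambda>n. x n i) \<longlonglongrightarrow> y i" for x y i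
    unfolding Gam_rho_def
    using that by (intro tendsto_add Kinf_tendsto[OF assms(1)] Gam_tendsto Gam_nonneg always_eventually)
      (auto simp: Gam_nonneg)
qed (use assms in auto)

end

subsection \<open>The MBI property from a path\<close>

text \<open>Halving \<open>\<rho>\<close> leaves a gap that is uniform over all \<open>x\<close> bounded away from zero.\<close>

lemma half_gain_slack:
  assumes "Kinf \<rho>" "0 < m"
  obtains e where "0 < e"
    "\<And>g x. 0 \<le> g \<Longrightarrow> m \<le> x \<Longrightarrow> g + \<rho> g \<le> x \<Longrightarrow> g + 1 / 2 * \<rho> g \<le> x - e"
proof -
  have "((\<lambda>r. r + \<rho> r) \<longlongrightarrow> 0 + \<rho> 0) (at_right 0)"
    by (intro tendsto_intros Kinf_tendsto[OF assms(1)])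
      (auto simp: eventually_at_right_less eventually_at_filter)
  then have "\<forall>\<^sub>F r in at_right 0. r + \<rho> r < m / 2"
    using assms(2) Kinf_zero[OF assms(1)] by (intro order_tendstoD) auto
  then obtain d where d: "0 < d" "\<And>r. 0 < r \<Longrightarrow> r < d \<Longrightarrow> r + \<rho> r < m / 2"
    by (auto simp: eventually_at_right_field)
  \<comment> \<open>Threshold for \<open>g\<close>: up to \<open>h\<close> the left-hand side is
    below \<open>m / 2\<close>, which leaves slack \<open>m / 2\<close>; above \<open>h\<close> the
    omitted half of \<open>\<rho> g\<close> is at least \<open>\<rho> h / 2\<close>.\<close>
  define h where "h = d / 2"
  have h: "0 < h" "h + \<rho> h < m / 2"
    using d(1) d(2)[of h] by (auto simp: h_def)
  have "0 < \<rho> h"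
    using Kinf_less[OF assms(1), of 0 h] Kinf_zero[OF assms(1)] h by simp
  show ?thesis
  proof (rule that[of "min (m / 2) (\<rho> h / 2)"])
    show "0 < min (m / 2) (\<rho> h / 2)"
      using assms \<open>0 < \<rho> h\<close> by simp
    fix g x assume g: "0 \<le> g" "m \<le> x" "g + \<rho> g \<le> x"
    show "g + 1 / 2 * \<rho> g \<le> x - min (m / 2) (\<rho> h / 2)"
    proof (cases "g \<le> h")
      case True
      then show ?thesis
        using Kinf_mono[OF assms(1) g(1) True] Kinf_nonneg[OF assms(1) g(1)] g h by linarith
    next
      case False
      then show ?thesis
        using Kinf_mono[OF assms(1), of h g] g h by linarith
    qed
  qed
qed

lemma path_imp_MBI:
  fixes \<sigma> :: "real \<Rightarrow> 'i \<Rightarrow> real"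
  assumes gain: "gain_operator II gam mu" and \<rho>: "Kinf \<rho>"
    and Psi: "\<And>r. 0 \<le> r \<Longrightarrow> \<sigma> r \<in> Psi (Gam_rho II gam mu \<rho>)"
    and Kinf_bounds: "Kinf \<phi>min" "Kinf \<phi>max"
    and bounds: "\<And>r i. 0 \<le> r \<Longrightarrow> \<phi>min r \<le> \<sigma> r i" "\<And>r i. 0 \<le> r \<Longrightarrow> \<sigma> r i \<le> \<phi>max r"
    and mono: "\<And>r1 r2 i. 0 \<le> r1 \<Longrightarrow> r1 \<le> r2 \<Longrightarrow> \<sigma> r1 i \<le> \<sigma> r2 i"
    and below: "\<And>rs r0. 0 \<le> r0 \<Longrightarrow> (\<And>n. 0 \<le> rs n \<and> rs n \<le> r0) \<Longrightarrow> rs \<longlonglongrightarrow> r0 \<Longrightarrow>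
      (\<lambda>n. linf_norm (\<lambda>i. \<sigma> (rs n) i - \<sigma> r0 i)) \<longlonglongrightarrow> 0"
    and above: "\<And>rs r0. 0 \<le> r0 \<Longrightarrow> (\<And>n. r0 \<le> rs n) \<Longrightarrow> rs \<longlonglongrightarrow> r0 \<Longrightarrow>
      weak_star_tendsto (\<lambda>n. \<sigma> (rs n)) (\<sigma> r0)"
  shows "oplus_MBI (Gam_rho II gam mu (\<lambda>r. 1 / 2 * \<rho> r))"
proof -
  \<comment> \<open>The proof yields \<open>\<phi>min r0 \<le> linf_norm b\<close>, that is
    \<open>r0 \<le> g (linf_norm b)\<close>, so \<open>\<phi>max\<close> composed with
    \<open>g\<close> is the MBI function.\<close>
  obtain g where g: "Kinf g" "\<And>r. 0 \<le> r \<Longrightarrow> g (\<phi>min r) = r"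
    using Kinf_inverse[OF Kinf_bounds(1)] by blast
  have pos: "\<sigma> r \<in> linf_pos" if "0 \<le> r" for r
    using Psi[OF that] by (simp add: Psi_def)
  have "linf_norm s \<le> \<phi>max (g (linf_norm b))"
    if s: "s \<in> linf_pos" and b: "b \<in> linf_pos"
      and le: "\<And>i. s i \<le> max (b i) (Gam_rho II gam mu (\<lambda>r. 1 / 2 * \<rho> r) s i)" for s b
  proof -
    define R where "R = {r. 0 \<le> r \<and> s \<le> \<sigma> r}"
    define r0 where "r0 = Inf R"
    \<comment> \<open>Unboundedness of \<open>\<phi>min\<close> makes \<open>R\<close>
      nonempty.\<close>
    obtain r1 where r1: "0 \<le> r1" "linf_norm s < \<phi>min r1"
      using Kinf_bounds(1) unfolding Kinf_def by blast
    have "s i \<le> \<sigma> r1 i" for i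
      using le_linf_norm[OF s, of i] bounds(1)[OF r1(1), of i] r1(2) by linarith
    then have "r1 \<in> R"
      using r1(1) by (simp add: R_def le_fun_def)
    have bdd: "bdd_below R"
      by (auto simp: R_def intro: bdd_belowI[of _ 0])
    have r0: "0 \<le> r0"
      unfolding r0_def using \<open>r1 \<in> R\<close> by (intro cInf_greatest) (auto simp: R_def)
    have s_le: "s i \<le> \<sigma> r0 i" for i
    proof -
      have lim: "(\<lambda>n. r0 + 1 / (real n + 1)) \<longlonglongrightarrow> r0"
        using tendsto_add[OF tendsto_const[of r0] LIMSEQ_inverse_real_of_nat]
        by (simp add: inverse_eq_divide add.commute)
      have "(\<lambda>n. \<sigma> (r0 + 1 / (real n + 1)) i) \<longlonglongrightarrow> \<sigma> r0 i"
        using above[OF r0 _ lim] by (auto simp: weak_star_tendsto_def)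
      moreover have "s i \<le> \<sigma> (r0 + 1 / (real n + 1)) i" for n
      proof -
        have "Inf R < r0 + 1 / (real n + 1)"
          by (simp add: r0_def add_pos_nonneg)
        then obtain r where "r \<in> R" "r < r0 + 1 / (real n + 1)"
          using \<open>r1 \<in> R\<close> cInf_lessD by blast
        then show ?thesis
          using mono[of r "r0 + 1 / (real n + 1)" i] by (auto simp: R_def le_fun_def intro: order_trans)
      qed
      ultimately show ?thesis
        by (intro LIMSEQ_le_const) auto
    qed
    have "\<phi>min r0 \<le> linf_norm b"
    proof (rule ccontr)
      assume "\<not> \<phi>min r0 \<le> linf_norm b"
      then have b_less: "linf_norm b < \<phi>min r0"
        by simp
      then have "0 < \<phi>min r0"
        using linf_norm_nonneg[OF b] by linarith
      then have "0 < r0"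
        using Kinf_zero[OF Kinf_bounds(1)] r0 by (cases "r0 = 0") auto
      \<comment> \<open>Every component of \<open>\<sigma> r0\<close> is at least
        \<open>\<phi>min r0\<close>, so a single \<open>e\<close> works for all indices.\<close>
      obtain e where e: "0 < e"
        "\<And>g x. 0 \<le> g \<Longrightarrow> \<phi>min r0 \<le> x \<Longrightarrow> g + \<rho> g \<le> x \<Longrightarrow> g + 1 / 2 * \<rho> g \<le> x - e"
        using half_gain_slack[OF \<rho> \<open>0 < \<phi>min r0\<close>] by blast
      define rs where "rs n = r0 * (1 - 1 / (real n + 1))" for n
      have rs: "0 \<le> rs n" "rs n < r0" for n
        using \<open>0 < r0\<close> by (auto simp: rs_def mult_less_cancel_left1 add_pos_nonneg)
      have "(\<lambda>n. r0 * (1 - inverse (real (Suc n)))) \<longlonglongrightarrow> r0 * (1 - 0)"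
        by (intro tendsto_intros LIMSEQ_inverse_real_of_nat)
      then have lim: "rs \<longlonglongrightarrow> r0"
        by (simp add: rs_def[abs_def] inverse_eq_divide add.commute)
      have "(\<lambda>n. linf_norm (\<lambda>i. \<sigma> (rs n) i - \<sigma> r0 i)) \<longlonglongrightarrow> 0"
        using rs by (intro below r0 lim) (auto intro: less_imp_le)
      then have "\<forall>\<^sub>F n in sequentially. linf_norm (\<lambda>i. \<sigma> (rs n) i - \<sigma> r0 i) < e"
        using e(1) by (rule order_tendstoD)
      moreover have "(\<lambda>n. \<phi>min (rs n)) \<longlonglongrightarrow> \<phi>min r0"
        using rs by (intro Kinf_tendsto[OF Kinf_bounds(1)] lim r0) auto
      then have "\<forall>\<^sub>F n in sequentially. linf_norm b < \<phi>min (rs n)"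
        using b_less by (rule order_tendstoD)
      ultimately have "\<forall>\<^sub>F n in sequentially.
        linf_norm (\<lambda>i. \<sigma> (rs n) i - \<sigma> r0 i) < e \<and> linf_norm b < \<phi>min (rs n)"
        by (rule eventually_conj)
      then obtain n where n: "linf_norm (\<lambda>i. \<sigma> (rs n) i - \<sigma> r0 i) < e" "linf_norm b < \<phi>min (rs n)"
        by (auto simp: eventually_sequentially)
      \<comment> \<open>In the \<open>\<Gamma>\<close> branch the gap \<open>e\<close> absorbs the
        drop from \<open>\<sigma> r0\<close> to \<open>\<sigma> (rs n)\<close>; in the
        \<open>b\<close> branch \<open>\<phi>min (rs n)\<close> still exceeds the norm of
        \<open>b\<close>.\<close>
      have "s i \<le> \<sigma> (rs n) i" for i
      proof -
        let ?G = "Gam II gam mu"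
        have G: "?G s i \<le> ?G (\<sigma> r0) i" "0 \<le> ?G s i"
          using s_le by (auto intro!: Gam_mono[OF gain] Gam_nonneg[OF gain] s pos r0 simp: le_fun_def)
        have "?G (\<sigma> r0) i + \<rho> (?G (\<sigma> r0) i) \<le> \<sigma> r0 i"
          using Psi[OF r0] by (auto simp: Psi_def Gam_rho_def)
        then have "?G (\<sigma> r0) i + 1 / 2 * \<rho> (?G (\<sigma> r0) i) \<le> \<sigma> r0 i - e"
          using G by (intro e(2) bounds(1) r0) auto
        moreover have "\<rho> (?G s i) \<le> \<rho> (?G (\<sigma> r0) i)"
          using G by (intro Kinf_mono[OF \<rho>])
        moreover have "\<bar>\<sigma> (rs n) i - \<sigma> r0 i\<bar> < e"
          using abs_diff_le_linf_norm[OF pos[OF rs(1)[of n]] pos[OF r0], of i] n(1) by linarith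
        ultimately have "Gam_rho II gam mu (\<lambda>r. 1 / 2 * \<rho> r) s i \<le> \<sigma> (rs n) i"
          using G(1) unfolding Gam_rho_def by linarith
        moreover have "b i \<le> \<sigma> (rs n) i"
          using le_linf_norm[OF b, of i] n(2) bounds(1)[OF rs(1)[of n], of i] by linarith
        ultimately show ?thesis
          using le[of i] by linarith
      qed
      then have "rs n \<in> R"
        using rs[of n] by (simp add: R_def le_fun_def)
      then have "r0 \<le> rs n"
        unfolding r0_def using bdd by (rule cInf_lower)
      then show False
        using rs(2)[of n] by simp
    qed
    then have "r0 \<le> g (linf_norm b)"
      using Kinf_mono[OF g(1), of "\<phi>min r0" "linf_norm b"] g(2)[OF r0]
        Kinf_nonneg[OF Kinf_bounds(1) r0] by simp
    then have "\<phi>max r0 \<le> \<phi>max (g (linf_norm b))"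
      by (intro Kinf_mono[OF Kinf_bounds(2) r0])
    moreover have "\<bar>s i\<bar> \<le> \<phi>max r0" for i
      using s_le[of i] bounds(2)[OF r0, of i] linf_pos_nonneg[OF s, of i] by linarith
    then have "linf_norm s \<le> \<phi>max r0"
      by (rule linf_norm_le)
    ultimately show ?thesis
      by linarith
  qed
  then show ?thesis
    unfolding oplus_MBI_def using Kinf_compose[OF Kinf_bounds(2) g(1)] by blast
qed

theorem theorem3p26:
  fixes II :: "'i::countable \<Rightarrow> 'i set"
    and gam :: "'i \<Rightarrow> 'i \<Rightarrow> real \<Rightarrow> real"
    and mu :: "'i \<Rightarrow> ('i \<Rightarrow> real) \<Rightarrow> ereal"
  assumes "gain_operator II gam mu"
  shows "(\<exists>\<rho>. Kinf \<rho> \<and> oplus_MBI (Gam_rho II gam mu \<rho>))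
     \<longleftrightarrow>
     (\<exists>\<rho> (\<sigma> :: real \<Rightarrow> 'i \<Rightarrow> real). Kinf \<rho>
        \<and> (\<forall>r\<ge>0. \<sigma> r \<in> Psi (Gam_rho II gam mu \<rho>))
        \<and> (\<exists>\<phi>min \<phi>max. Kinf \<phi>min \<and> Kinf \<phi>max \<and>
             (\<forall>r\<ge>0. \<forall>i. \<phi>min r \<le> \<sigma> r i \<and> \<sigma> r i \<le> \<phi>max r))
        \<and> (\<forall>r1 r2. 0 \<le> r1 \<longrightarrow> r1 \<le> r2 \<longrightarrow> (\<forall>i. \<sigma> r1 i \<le> \<sigma> r2 i))
        \<and> (\<forall>(rs :: nat \<Rightarrow> real) r0. 0 \<le> r0 \<longrightarrow> (\<forall>n. 0 \<le> rs n \<and> rs n \<le> r0) \<longrightarrow>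
              rs \<longlonglongrightarrow> r0 \<longrightarrow>
              (\<lambda>n. linf_norm (\<lambda>i. \<sigma> (rs n) i - \<sigma> r0 i)) \<longlonglongrightarrow> 0)
        \<and> (\<forall>(rs :: nat \<Rightarrow> real) r0. 0 \<le> r0 \<longrightarrow> (\<forall>n. r0 \<le> rs n) \<longrightarrow>
              rs \<longlonglongrightarrow> r0 \<longrightarrow>
              weak_star_tendsto (\<lambda>n. \<sigma> (rs n)) (\<sigma> r0)))"
    (is "?A \<longleftrightarrow> ?B")
proof
  assume ?A
  then obtain \<rho> \<phi> where \<rho>: "Kinf \<rho>" and \<phi>: "Kinf \<phi>"
    and mbi: "\<forall>s\<in>linf_pos. \<forall>b\<in>linf_pos. (\<forall>i. s i \<le> max (b i) (Gam_rho II gam mu \<rho> s i)) \<longrightarrow>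
      linf_norm s \<le> \<phi> (linf_norm b)"
    unfolding oplus_MBI_def by blast
  interpret oplus_MBI_operator "Gam_rho II gam mu \<rho>" \<phi>
    by (rule MBI_operator_Gam_rho[OF assms \<rho> \<phi>]) (use mbi in blast)
  show ?B
  proof (rule exI[of _ \<rho>], rule exI[of _ path], intro conjI)
    have "Kinf (\<lambda>r. 1 / 2 * r)"
      using Kinf_scale[OF Kinf_id, of "1 / 2"] by simp
    moreover have "Kinf (\<lambda>r. \<phi> (2 * r))"
      using Kinf_scale_arg[OF \<phi>, of 2] by simp
    moreover have "\<forall>r\<ge>0. \<forall>i. 1 / 2 * r \<le> path r i \<and> path r i \<le> \<phi> (2 * r)"
      using path_bounds by simp
    ultimately show "\<exists>\<phi>min \<phi>max. Kinf \<phi>min \<and> Kinf \<phi>max \<and>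
        (\<forall>r\<ge>0. \<forall>i. \<phi>min r \<le> path r i \<and> path r i \<le> \<phi>max r)"
      by blast
  qed (use \<rho> path_Psi path_mono path_norm_tendsto_below path_weak_star_tendsto_above in blast)+
next
  assume ?B
  then obtain \<rho> \<sigma> \<phi>min \<phi>max where "Kinf \<rho>"
    and "\<forall>r\<ge>0. \<sigma> r \<in> Psi (Gam_rho II gam mu \<rho>)"
    and "Kinf \<phi>min" "Kinf \<phi>max" "\<forall>r\<ge>0. \<forall>i. \<phi>min r \<le> \<sigma> r i \<and> \<sigma> r i \<le> \<phi>max r"
    and "\<forall>r1 r2. 0 \<le> r1 \<longrightarrow> r1 \<le> r2 \<longrightarrow> (\<forall>i. \<sigma> r1 i \<le> \<sigma> r2 i)"
    and "\<forall>(rs :: nat \<Rightarrow> real) r0. 0 \<le> r0 \<longrightarrow> (\<forall>n. 0 \<le> rs n \<and> rs n \<le> r0) \<longrightarrow>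
      rs \<longlonglongrightarrow> r0 \<longrightarrow> (\<lambda>n. linf_norm (\<lambda>i. \<sigma> (rs n) i - \<sigma> r0 i)) \<longlonglongrightarrow> 0"
    and "\<forall>(rs :: nat \<Rightarrow> real) r0. 0 \<le> r0 \<longrightarrow> (\<forall>n. r0 \<le> rs n) \<longrightarrow>
      rs \<longlonglongrightarrow> r0 \<longrightarrow> weak_star_tendsto (\<lambda>n. \<sigma> (rs n)) (\<sigma> r0)"
    by (elim exE conjE) (rule that)
  then have "oplus_MBI (Gam_rho II gam mu (\<lambda>r. 1 / 2 * \<rho> r))"
    by (intro path_imp_MBI[OF assms, where \<rho> = \<rho> and \<sigma> = \<sigma> and \<phi>min = \<phi>min and \<phi>max = \<phi>max]) blast+
  moreover have "Kinf (\<lambda>r. 1 / 2 * \<rho> r)"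
    using \<open>Kinf \<rho>\<close> by (intro Kinf_scale) auto
  ultimately show ?A
    by blast
qed

end
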